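(* Let $s\ge 1$ and $k\ge 2$ be integers and let $u=(u_1,\dots,u_{k-1})$ be a $(k-1)$-tuple of positive integers with $\gcd(u_i,u_j)=1$ for all $1\le i\neq j\le k-1$. Then the probability that $s$ positive integers $a_1,\dots,a_s$ are $k$-wise relatively prime and are $i$-wise relatively prime to $u_i$ for $i=1,2,\dots,k-1$ exists and equals $$\lim_{n\to\infty}\frac{Q_{s,k}^{(u)}(n)}{n^s}=A_{s,k}\prod_{i=1}^{k-1}f_{s,k,i}(u_i),$$ where $$A_{s,k}=\prod_{p}\left[\left(1-\frac1p\right)^{s-k+1}\sum_{m=0}^{k-1}\binom{s}{m}\left(1-\frac1p\right)^{k-1-m}\frac{1}{p^m}\right]$$ (product over all primes $p$) and $$f_{s,k,i}(u_i)=\prod_{p\mid u_i}\left(1-\frac{\sum_{m=i}^{k-1}\binom{s}{m}(p-1)^{k-1-m}}{\sum_{m=0}^{k-1}\binom{s}{m}(p-1)^{k-1-m}}\right)$$ (product over the primes $p$ dividing $u_i$). In particular, taking $u_1=u_2=\cdots=u_{k-1}=1$, the probability that $s$ positive integers are $k$-wise relatively prime is $A_{s,k}$.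
   Context: Positive integers $a_1,\dots,a_s$ are called $k$-wise relatively prime if for any $k$ of them (any $k$ distinct indices) the greatest common divisor of those $k$ integers is $1$ (a vacuous condition if $k>s$). They are called $i$-wise relatively prime to a positive integer $a$ if the gcd of any $i$ of them (any $i$ distinct indices) is relatively prime to $a$ (vacuous if $i>s$). For a $(k-1)$-tuple of positive integers $u=(u_1,\dots,u_{k-1})$, $Q_{s,k}^{(u)}(n)$ denotes the number of $s$-tuples $(a_1,\dots,a_s)$ of integers with $1\le a_1,\dots,a_s\le n$ such that $a_1,\dots,a_s$ are $k$-wise relatively prime and are $i$-wise relatively prime to $u_i$ for each $i=1,2,\dots,k-1$. The "probability" that $s$ positive integers have a property means the limit as $n\to\infty$ of the proportion of $s$-tuples in $\{1,\dots,n\}^s$ having it. Convention: $\binom{a}{b}=0$ if $b>a\ge 0$. *)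

theory Defs
  imports "HOL-Analysis.Infinite_Products" "HOL-Computational_Algebra.Primes"
    "HOL-Library.FuncSet"
begin

text \<open>
  An \<open>s\<close>-tuple of positive integers is a function on the index set \<open>{1..s}\<close>; only its
  values on that set matter.
\<close>

definition kwise_coprime :: "nat \<Rightarrow> nat \<Rightarrow> (nat \<Rightarrow> nat) \<Rightarrow> bool" where
  "kwise_coprime s k a \<longleftrightarrow> (\<forall>I. I \<subseteq> {1..s} \<and> card I = k \<longrightarrow> Gcd (a ` I) = 1)"

definition iwise_coprime_to :: "nat \<Rightarrow> nat \<Rightarrow> (nat \<Rightarrow> nat) \<Rightarrow> nat \<Rightarrow> bool" where
  "iwise_coprime_to s i a b \<longleftrightarrow>
     (\<forall>I. I \<subseteq> {1..s} \<and> card I = i \<longrightarrow> coprime (Gcd (a ` I)) b)"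

definition tuples :: "nat \<Rightarrow> nat \<Rightarrow> (nat \<Rightarrow> nat) set" where
  "tuples s n = {1..s} \<rightarrow>\<^sub>E {1..n}"

definition has_probability :: "nat \<Rightarrow> ((nat \<Rightarrow> nat) \<Rightarrow> bool) \<Rightarrow> real \<Rightarrow> bool" where
  "has_probability s P x \<longleftrightarrow>
     (\<lambda>n. real (card {a \<in> tuples s n. P a}) / real (card (tuples s n))) \<longlonglongrightarrow> x"

text \<open>The tuple \<open>u\<close> is given by the values of a function at the indices \<open>1, \<dots>, k - 1\<close>.\<close>

definition Qcount :: "nat \<Rightarrow> nat \<Rightarrow> (nat \<Rightarrow> nat) \<Rightarrow> nat \<Rightarrow> nat" where
  "Qcount s k u n = card {a \<in> tuples s n.
     kwise_coprime s k a \<and> (\<forall>i\<in>{1..k-1}. iwise_coprime_to s i a (u i))}"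

text \<open>The exponent \<open>s - k + 1\<close> is negative when \<open>s < k - 1\<close>, hence the integer power.\<close>

definition A_factor :: "nat \<Rightarrow> nat \<Rightarrow> nat \<Rightarrow> real" where
  "A_factor s k p =
     (1 - 1 / real p) powi (int s - int k + 1) *
     (\<Sum>m=0..k-1. real (s choose m) * (1 - 1 / real p) ^ (k - 1 - m) * (1 / real p ^ m))"

text \<open>
  Products over all primes are infinite products over the naturals with factor 1 at non-primes.
\<close>

definition A_prime_factor :: "nat \<Rightarrow> nat \<Rightarrow> nat \<Rightarrow> real" where
  "A_prime_factor s k p = (if prime p then A_factor s k p else 1)"

definition A_const :: "nat \<Rightarrow> nat \<Rightarrow> real" where
  "A_const s k = (\<Prod>p. A_prime_factor s k p)"

definition f_const :: "nat \<Rightarrow> nat \<Rightarrow> nat \<Rightarrow> nat \<Rightarrow> real" where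
  "f_const s k i v = (\<Prod>p | prime p \<and> p dvd v.
     1 - (\<Sum>m=i..k-1. real (s choose m) * (real p - 1) ^ (k - 1 - m)) /
         (\<Sum>m=0..k-1. real (s choose m) * (real p - 1) ^ (k - 1 - m)))"

end

theory Submission
  imports Defs
begin

text \<open>
  The condition on a tuple \<open>a\<close> says that for every prime \<open>p\<close> fewer than \<open>t p\<close> of its entries
  are divisible by \<open>p\<close>, where \<open>t p = i\<close> if \<open>p\<close> divides some (necessarily unique) \<open>u i\<close> and
  \<open>t p = k\<close> otherwise. For the primes up to \<open>N\<close> alone, the divisibility patterns are
  asymptotically independent, so the density is a finite product of binomial probabilities.
  A tuple that satisfies these but fails at some prime \<open>p > N\<close> has two entries divisible
  by \<open>p\<close>; since the sum of \<open>1 / p\<^sup>2\<close> over \<open>p > N\<close> is at most \<open>1 / N\<close>, such tuples have upper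
  density at most \<open>s\<^sup>2 / N\<close>, and one lets \<open>N\<close> tend to infinity.
\<close>

section \<open>Integers with prescribed divisibility by finitely many primes\<close>

lemma card_multiples:
  assumes "d > 0"
  shows "card {x \<in> {1..n::nat}. d dvd x} = n div d"
proof -
  have "{x \<in> {1..n}. d dvd x} = (\<lambda>q. d * q) ` {1..n div d}"
  proof (intro equalityI subsetI)
    fix x assume "x \<in> {x \<in> {1..n}. d dvd x}"
    then obtain q where "x = d * q" "1 \<le> x" "x \<le> n"
      by (auto elim: dvdE)
    then have "q \<in> {1..n div d}"
      using \<open>d > 0\<close> by (auto simp: less_eq_div_iff_mult_less_eq mult.commute Suc_le_eq)
    then show "x \<in> (\<lambda>q. d * q) ` {1..n div d}"
      using \<open>x = d * q\<close> by blast
  next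
    fix x assume "x \<in> (\<lambda>q. d * q) ` {1..n div d}"
    then show "x \<in> {x \<in> {1..n}. d dvd x}"
      using \<open>d > 0\<close> by (auto simp: less_eq_div_iff_mult_less_eq mult.commute Suc_le_eq)
  qed
  moreover have "inj_on (\<lambda>q. d * q) {1..n div d}"
    using \<open>d > 0\<close> by (auto simp: inj_on_def)
  ultimately show ?thesis by (simp add: card_image)
qed

text \<open>Since \<open>q\<close> is coprime to \<open>d\<close>, excluding the multiples of a
  further prime \<open>q\<close> subtracts the count for the modulus \<open>d * q\<close> from the
  count for \<open>d\<close>. The modulus therefore varies in the induction on
  \<open>V\<close>.\<close>

lemma sieve_density:
  assumes "finite V" and "\<And>p. p \<in> V \<Longrightarrow> prime p" and "d > 0"
    and "\<And>p. p \<in> V \<Longrightarrow> coprime p d"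
  shows "(\<lambda>n. real (card {x \<in> {1..n::nat}. d dvd x \<and> (\<forall>p\<in>V. \<not> p dvd x)}) / real n)
           \<longlonglongrightarrow> 1 / real d * (\<Prod>p\<in>V. 1 - 1 / real p)"
  using assms
proof (induction V arbitrary: d rule: finite_induct)
  case empty
  have "(\<lambda>n. real (n div d) / real n) \<longlonglongrightarrow> 1 / real d"
  proof (rule tendsto_sandwich)
    show "\<forall>\<^sub>F n in sequentially. 1 / real d - 1 / real n \<le> real (n div d) / real n"
    proof (rule eventually_sequentiallyI[of 1])
      fix n :: nat assume "1 \<le> n"
      have "real n / real d - 1 \<le> real (n div d)"
        using floor_divide_of_nat_eq[where 'a = real, of n d] by linarith
      then have "(real n / real d - 1) / real n \<le> real (n div d) / real n"
        by (rule divide_right_mono) simp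
      then show "1 / real d - 1 / real n \<le> real (n div d) / real n"
        using \<open>1 \<le> n\<close> by (simp add: diff_divide_distrib)
    qed
    show "\<forall>\<^sub>F n in sequentially. real (n div d) / real n \<le> 1 / real d"
    proof (rule eventually_sequentiallyI[of 1])
      fix n :: nat assume "1 \<le> n"
      have "real (n div d) / real n \<le> (real n / real d) / real n"
        by (rule divide_right_mono[OF of_nat_div_le_of_nat]) simp
      then show "real (n div d) / real n \<le> 1 / real d"
        using \<open>1 \<le> n\<close> by simp
    qed
    show "(\<lambda>n. 1 / real d - 1 / real n) \<longlonglongrightarrow> 1 / real d"
      using tendsto_diff[OF tendsto_const lim_1_over_n, of "1 / real d"] by simp
  qed simp
  then show ?case using card_multiples[OF empty.prems(2)] by simp
next
  case (insert q V)
  let ?C = "\<lambda>d n. {x \<in> {1..n::nat}. d dvd x \<and> (\<forall>p\<in>V. \<not> p dvd x)}"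
  have q: "prime q" "coprime q d" "q > 0"
    using insert.prems by (auto simp: prime_gt_0_nat)
  have "coprime p q" if "p \<in> V" for p
    using that insert by (metis insertI1 insertI2 primes_coprime)
  then have "(\<lambda>n. real (card (?C (d * q) n)) / real n)
      \<longlonglongrightarrow> 1 / real (d * q) * (\<Prod>p\<in>V. 1 - 1 / real p)"
    using insert.prems q by (intro insert.IH) auto
  moreover have "(\<lambda>n. real (card (?C d n)) / real n) \<longlonglongrightarrow> 1 / real d * (\<Prod>p\<in>V. 1 - 1 / real p)"
    using insert.prems by (intro insert.IH) auto
  ultimately have "(\<lambda>n. real (card (?C d n)) / real n - real (card (?C (d * q) n)) / real n)
      \<longlonglongrightarrow> 1 / real d * (\<Prod>p\<in>V. 1 - 1 / real p) - 1 / real (d * q) * (\<Prod>p\<in>V. 1 - 1 / real p)"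
    by (intro tendsto_diff)
  moreover have "real (card (?C d n)) / real n - real (card (?C (d * q) n)) / real n =
      real (card {x \<in> {1..n}. d dvd x \<and> (\<forall>p\<in>insert q V. \<not> p dvd x)}) / real n" for n
  proof -
    have dq: "d * q dvd x \<longleftrightarrow> d dvd x \<and> q dvd x" for x
      using q(2) by (metis coprime_commute divides_mult dvd_mult_left dvd_mult_right)
    have "{x \<in> {1..n}. d dvd x \<and> (\<forall>p\<in>insert q V. \<not> p dvd x)} = ?C d n - ?C (d * q) n"
      by (auto simp: dq)
    moreover have "?C (d * q) n \<subseteq> ?C d n"
      by (auto simp: dq)
    ultimately have "card {x \<in> {1..n}. d dvd x \<and> (\<forall>p\<in>insert q V. \<not> p dvd x)}
        = card (?C d n) - card (?C (d * q) n)" "card (?C (d * q) n) \<le> card (?C d n)"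
      by (auto simp: card_Diff_subset intro!: card_mono)
    then show ?thesis
      by (simp add: of_nat_diff diff_divide_distrib)
  qed
  moreover have "1 / real d * (\<Prod>p\<in>V. 1 - 1 / real p) - 1 / real (d * q) * (\<Prod>p\<in>V. 1 - 1 / real p)
      = 1 / real d * (\<Prod>p\<in>insert q V. 1 - 1 / real p)"
    using insert.hyps by (simp add: algebra_simps)
  ultimately show ?case by simp
qed

text \<open>Distinct primes are coprime, so several divisibility conditions merge into the single
  modulus that \<open>sieve_density\<close> expects.\<close>

lemma prod_primes_dvd_iff:
  fixes x :: nat
  assumes "finite U" and "\<And>p. p \<in> U \<Longrightarrow> prime p"
  shows "\<Prod>U dvd x \<longleftrightarrow> (\<forall>p\<in>U. p dvd x)"
  using assms
proof (induction U rule: finite_induct)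
  case (insert q U)
  have "coprime q (\<Prod>U)"
    by (rule prod_coprime_right) (metis insert.hyps(2) insert.prems insertI1 insertI2 primes_coprime)
  then show ?case
    using insert by (auto intro: divides_mult dvd_mult_left dvd_mult_right)
qed simp

text \<open>This is the sieve with modulus \<open>\<Prod>(S \<inter> U)\<close> and excluded primes
  \<open>S - U\<close>. The limit is a product over \<open>S\<close>, which expresses asymptotic
  independence for a single integer.\<close>

lemma divisibility_pattern_density:
  assumes "finite S" and "\<And>p. p \<in> S \<Longrightarrow> prime p"
  shows "(\<lambda>n. real (card {x \<in> {1..n::nat}. \<forall>p\<in>S. p dvd x \<longleftrightarrow> p \<in> U}) / real n)
           \<longlonglongrightarrow> (\<Prod>p\<in>S. if p \<in> U then 1 / real p else 1 - 1 / real p)"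
proof -
  have "(\<lambda>n. real (card {x \<in> {1..n::nat}. \<Prod>(S \<inter> U) dvd x \<and> (\<forall>p\<in>S - U. \<not> p dvd x)}) / real n)
      \<longlonglongrightarrow> 1 / real (\<Prod>(S \<inter> U)) * (\<Prod>p\<in>S - U. 1 - 1 / real p)"
  proof (rule sieve_density)
    show "\<Prod>(S \<inter> U) > 0"
      using assms by (auto intro!: prod_pos simp: prime_gt_0_nat)
    show "coprime p (\<Prod>(S \<inter> U))" if "p \<in> S - U" for p
      by (rule prod_coprime_right) (metis DiffE IntE assms(2) primes_coprime that)
  qed (use assms in auto)
  moreover have "(\<Prod>(S \<inter> U) dvd x \<and> (\<forall>p\<in>S - U. \<not> p dvd x)) = (\<forall>p\<in>S. p dvd x \<longleftrightarrow> p \<in> U)" for x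
    using prod_primes_dvd_iff[of "S \<inter> U" x] assms by auto
  moreover have "(\<Prod>p\<in>S. if p \<in> U then 1 / real p else 1 - 1 / real p) =
      1 / real (\<Prod>(S \<inter> U)) * (\<Prod>p\<in>S - U. 1 - 1 / real p)"
    using assms(1) by (simp add: prod.If_cases prod_dividef Diff_eq)
  ultimately show ?thesis by simp
qed

section \<open>Tuples and independence across finitely many primes\<close>

lemma card_tuples: "card (tuples s n) = n ^ s"
  by (simp add: tuples_def card_PiE)

lemma finite_tuples: "finite (tuples s n)"
  by (auto simp: tuples_def intro: finite_PiE)

lemma tuples_coordinatewise:
  "{a \<in> tuples s n. \<forall>j\<in>{1..s}. R j (a j)} = (\<Pi>\<^sub>E j\<in>{1..s}. {x \<in> {1..n}. R j x})"
  by (auto simp: tuples_def PiE_iff extensional_def simp del: atLeastAtMost_iff)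

lemma card_tuples_coordinatewise:
  "card {a \<in> tuples s n. \<forall>j\<in>{1..s}. R j (a j)} = (\<Prod>j\<in>{1..s}. card {x \<in> {1..n}. R j x})"
  unfolding tuples_coordinatewise by (simp add: card_PiE)

text \<open>The tuples are split by their full divisibility pattern \<open>T\<close>, where
  \<open>T p\<close> is the set of indices whose entry is divisible by \<open>p\<close>. For fixed
  \<open>T\<close> the condition is coordinatewise, so the count is a product of counts of integers;
  summing over \<open>T\<close> then factors over the primes.\<close>

lemma finitely_many_primes_density:
  assumes "finite S" and "\<And>p. p \<in> S \<Longrightarrow> prime p" and "\<And>p. p \<in> S \<Longrightarrow> F p \<subseteq> Pow {1..s}"
  shows "(\<lambda>n. real (card {a \<in> tuples s n. \<forall>p\<in>S. {j \<in> {1..s}. p dvd a j} \<in> F p}) / real n ^ s)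
           \<longlonglongrightarrow> (\<Prod>p\<in>S. \<Sum>T\<in>F p. \<Prod>j\<in>{1..s}. if j \<in> T then 1 / real p else 1 - 1 / real p)"
proof -
  define X where "X T n = {a \<in> tuples s n. \<forall>j\<in>{1..s}. \<forall>p\<in>S. p dvd a j \<longleftrightarrow> p \<in> {p. j \<in> T p}}"
    for T n
  have finF: "finite (F p)" if "p \<in> S" for p
    using assms(3)[OF that] by (rule finite_subset) simp
  have finP: "finite (PiE S F)"
    using assms(1) finF by (rule finite_PiE)
  have XT: "T p = {j \<in> {1..s}. p dvd a j}" if "T \<in> PiE S F" "a \<in> X T n" "p \<in> S" for T a n p
  proof -
    have "T p \<subseteq> {1..s}"
      using that assms(3)[of p] by auto
    then show ?thesis
      using that by (auto simp: X_def)
  qed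
  have union: "{a \<in> tuples s n. \<forall>p\<in>S. {j \<in> {1..s}. p dvd a j} \<in> F p} = (\<Union>T\<in>PiE S F. X T n)" for n
  proof (intro equalityI subsetI)
    fix a assume a: "a \<in> {a \<in> tuples s n. \<forall>p\<in>S. {j \<in> {1..s}. p dvd a j} \<in> F p}"
    \<comment> \<open>The pattern of \<open>a\<close> itself, restricted to \<open>S\<close> because
      members of \<open>PiE S F\<close> are \<open>undefined\<close> elsewhere.\<close>
    let ?T = "\<lambda>p\<in>S. {j \<in> {1..s}. p dvd a j}"
    have "?T \<in> PiE S F" "a \<in> X ?T n"
      using a by (auto simp: X_def)
    then show "a \<in> (\<Union>T\<in>PiE S F. X T n)" by blast
  next
    fix a assume "a \<in> (\<Union>T\<in>PiE S F. X T n)"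
    then obtain T where T: "T \<in> PiE S F" "a \<in> X T n" by blast
    then have "{j \<in> {1..s}. p dvd a j} \<in> F p" if "p \<in> S" for p
      using XT[OF T that] that by (metis PiE_mem)
    then show "a \<in> {a \<in> tuples s n. \<forall>p\<in>S. {j \<in> {1..s}. p dvd a j} \<in> F p}"
      using T by (auto simp: X_def)
  qed
  have disj: "X T n \<inter> X T' n = {}" if "T \<in> PiE S F" "T' \<in> PiE S F" "T \<noteq> T'" for T T' n
  proof (rule ccontr)
    assume "X T n \<inter> X T' n \<noteq> {}"
    then obtain a where a: "a \<in> X T n" "a \<in> X T' n" by blast
    have "T p = T' p" if "p \<in> S" for p
      using XT[OF \<open>T \<in> PiE S F\<close> a(1) that] XT[OF \<open>T' \<in> PiE S F\<close> a(2) that] by simp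
    then have "T = T'"
      by (rule PiE_ext[OF that(1,2)])
    with that show False by simp
  qed
  have card: "card {a \<in> tuples s n. \<forall>p\<in>S. {j \<in> {1..s}. p dvd a j} \<in> F p} =
      (\<Sum>T\<in>PiE S F. card (X T n))" for n
    unfolding union
    by (rule card_UN_disjoint) (use finP disj in \<open>auto simp: X_def finite_tuples\<close>)
  have "(\<lambda>n. real (card (X T n)) / real n ^ s) \<longlonglongrightarrow>
      (\<Prod>j\<in>{1..s}. \<Prod>p\<in>S. if p \<in> {p. j \<in> T p} then 1 / real p else 1 - 1 / real p)" for T
  proof -
    have "card (X T n) = (\<Prod>j\<in>{1..s}. card {x \<in> {1..n}. \<forall>p\<in>S. p dvd x \<longleftrightarrow> p \<in> {p. j \<in> T p}})" for n
      unfolding X_def by (rule card_tuples_coordinatewise)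
    then have "real (card (X T n)) / real n ^ s =
        (\<Prod>j\<in>{1..s}. real (card {x \<in> {1..n}. \<forall>p\<in>S. p dvd x \<longleftrightarrow> p \<in> {p. j \<in> T p}}) / real n)" for n
      by (simp add: prod_dividef)
    then show ?thesis
      using assms(1,2) by (simp only:) (intro tendsto_prod divisibility_pattern_density; blast)
  qed
  then have "(\<lambda>n. \<Sum>T\<in>PiE S F. real (card (X T n)) / real n ^ s) \<longlonglongrightarrow>
      (\<Sum>T\<in>PiE S F. \<Prod>j\<in>{1..s}. \<Prod>p\<in>S. if p \<in> {p. j \<in> T p} then 1 / real p else 1 - 1 / real p)"
    by (intro tendsto_sum)
  \<comment> \<open>Distributivity expands the product of sums into a sum over choice functions;
    exchanging the products over \<open>p\<close> and \<open>j\<close> makes both sides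
    agree.\<close>
  moreover have "(\<Sum>T\<in>PiE S F. \<Prod>j\<in>{1..s}. \<Prod>p\<in>S. if p \<in> {p. j \<in> T p} then 1 / real p else 1 - 1 / real p)
      = (\<Prod>p\<in>S. \<Sum>T\<in>F p. \<Prod>j\<in>{1..s}. if j \<in> T then 1 / real p else 1 - 1 / real p)"
    using assms(1) finF by (subst prod_sum_PiE, simp_all, subst prod.swap, simp)
  ultimately show ?thesis
    by (simp only: card of_nat_sum sum_divide_distrib)
qed

section \<open>Binomial probabilities at a single prime\<close>

text \<open>\<open>local_density s t p\<close> is the probability that a binomial variable with parameters
  \<open>s\<close> and \<open>1/p\<close> is less than \<open>t\<close>.\<close>

definition local_density :: "nat \<Rightarrow> nat \<Rightarrow> nat \<Rightarrow> real" where
  "local_density s t p = (\<Sum>m<t. real (s choose m) * (1 / real p) ^ m * (1 - 1 / real p) ^ (s - m))"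

text \<open>The weight of \<open>T\<close> depends only on its cardinality \<open>m\<close>, and
  there are \<open>s choose m\<close> sets of that size.\<close>

lemma sum_patterns_eq_local_density:
  "(\<Sum>T\<in>{T. T \<subseteq> {1..s} \<and> card T < t}. \<Prod>j\<in>{1..s}. if j \<in> T then 1 / real p else 1 - 1 / real p)
     = local_density s t p"
proof -
  let ?S = "{T. T \<subseteq> {1..s} \<and> card T < t}"
  let ?h = "\<lambda>m. (1 / real p) ^ m * (1 - 1 / real p) ^ (s - m)"
  have fin: "finite ?S"
    by (rule finite_subset[of _ "Pow {1..s}"]) auto
  have "(\<Prod>j\<in>{1..s}. if j \<in> T then 1 / real p else 1 - 1 / real p) = ?h (card T)" if "T \<in> ?S" for T
  proof -
    have "{1..s} \<inter> T = T" "finite T" and "card ({1..s} \<inter> - T) = s - card T"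
      using that card_Diff_subset[of T "{1..s}"] by (auto simp: Diff_eq[symmetric] dest: finite_subset)
    then show ?thesis by (simp add: prod.If_cases)
  qed
  then have "(\<Sum>T\<in>?S. \<Prod>j\<in>{1..s}. if j \<in> T then 1 / real p else 1 - 1 / real p) = (\<Sum>T\<in>?S. ?h (card T))"
    by (rule sum.cong[OF refl])
  also have "\<dots> = (\<Sum>m<t. \<Sum>T | T \<in> ?S \<and> card T = m. ?h (card T))"
    by (rule sum.group[symmetric]) (use fin in auto)
  also have "\<dots> = (\<Sum>m<t. real (s choose m) * ?h m)"
  proof (rule sum.cong[OF refl])
    fix m assume "m \<in> {..<t}"
    then have "{T \<in> ?S. card T = m} = {T. T \<subseteq> {1..s} \<and> card T = m}" by auto
    then have "card {T \<in> ?S. card T = m} = s choose m"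
      using n_subsets[of "{1..s}" m] by simp
    then show "(\<Sum>T | T \<in> ?S \<and> card T = m. ?h (card T)) = real (s choose m) * ?h m"
      by simp
  qed
  finally show ?thesis
    by (simp add: local_density_def mult.assoc)
qed

lemma local_density_eq_1: "s < t \<Longrightarrow> local_density s t p = 1"
proof -
  assume "s < t"
  then have "local_density s t p =
      (\<Sum>m\<le>s. real (s choose m) * (1 / real p) ^ m * (1 - 1 / real p) ^ (s - m))"
    unfolding local_density_def by (intro sum.mono_neutral_right) auto
  also have "\<dots> = (1 / real p + (1 - 1 / real p)) ^ s"
    by (rule binomial_ring[symmetric])
  finally show ?thesis by simp
qed

text \<open>The complementary probability is the binomial tail from \<open>t\<close> on, and for
  \<open>t \<ge> 2\<close> each of its terms contains at least two factors \<open>1 / p\<close>.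
  This bound makes the product over all primes converge.\<close>

lemma local_density_bound:
  assumes "t \<ge> 2" and "p > 0"
  shows "\<bar>local_density s t p - 1\<bar> \<le> 2 ^ s * (1 / real p ^ 2)"
proof (cases "s < t")
  case False
  let ?g = "\<lambda>m. real (s choose m) * (1 / real p) ^ m * (1 - 1 / real p) ^ (s - m)"
  have x: "0 \<le> 1 / real p" "1 / real p \<le> 1"
    using assms by auto
  have split: "{..<Suc s} = {..<t} \<union> {t..s}" using False by auto
  \<comment> \<open>The threshold \<open>Suc s\<close> carries the total mass 1, so splitting there
    at \<open>t\<close> isolates the tail.\<close>
  have "local_density s (Suc s) p = local_density s t p + (\<Sum>m=t..s. ?g m)"
    unfolding local_density_def split by (rule sum.union_disjoint) auto
  then have "1 - local_density s t p = (\<Sum>m=t..s. ?g m)"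
    by (simp add: local_density_eq_1)
  moreover have "0 \<le> (\<Sum>m=t..s. ?g m)"
    using x by (intro sum_nonneg mult_nonneg_nonneg) auto
  moreover have "(\<Sum>m=t..s. ?g m) \<le> (\<Sum>m=t..s. real (s choose m) * (1 / real p) ^ 2 * 1)"
    using x assms by (intro sum_mono mult_mono power_decreasing power_le_one) auto
  moreover have "(\<Sum>m=t..s. real (s choose m) * (1 / real p) ^ 2 * 1) \<le>
      (\<Sum>m\<le>s. real (s choose m) * (1 / real p) ^ 2 * 1)"
    by (rule sum_mono2) auto
  moreover have "(\<Sum>m\<le>s. real (s choose m) * (1 / real p) ^ 2 * 1) = 2 ^ s * (1 / real p ^ 2)"
    by (simp add: sum_divide_distrib[symmetric] power_divide of_nat_sum[symmetric]
        choose_row_sum del: of_nat_sum)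
  ultimately show ?thesis by linarith
qed (simp add: local_density_eq_1)

text \<open>The term \<open>m = 0\<close> is already positive. This keeps the denominators in
  \<open>f_const\<close> away from zero.\<close>

lemma local_density_pos:
  assumes "t \<ge> 1" and "p \<ge> 2"
  shows "local_density s t p > 0"
proof -
  have "0 < (1 - 1 / real p) ^ s"
    using assms by (intro zero_less_power) (simp add: field_simps)
  also have "\<dots> = (\<Sum>m\<in>{0}. real (s choose m) * (1 / real p) ^ m * (1 - 1 / real p) ^ (s - m))"
    by simp
  also have "\<dots> \<le> local_density s t p"
    unfolding local_density_def using assms
    by (intro sum_mono2) auto
  finally show ?thesis .
qed

text \<open>Splitting the exponent as \<open>s - m = (s - k + 1) + (k - 1 - m)\<close> pulls out the
  power that occurs in \<open>A_factor\<close>. The bound \<open>t \<le> k\<close> keeps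
  \<open>k - 1 - m\<close> free of truncation.\<close>

lemma local_density_eq:
  assumes "k \<ge> 1" and "t \<le> k" and "p \<ge> 2"
  shows "local_density s t p = (1 - 1 / real p) powi (int s - int k + 1) *
    (\<Sum>m<t. real (s choose m) * (1 - 1 / real p) ^ (k - 1 - m) * (1 / real p ^ m))"
  unfolding local_density_def sum_distrib_left
proof (rule sum.cong[OF refl])
  fix m assume "m \<in> {..<t}"
  then have m: "m \<le> k - 1" using assms by auto
  have nz: "1 - 1 / real p \<noteq> 0"
    using assms by (simp add: field_simps)
  show "real (s choose m) * (1 / real p) ^ m * (1 - 1 / real p) ^ (s - m) =
      (1 - 1 / real p) powi (int s - int k + 1) *
      (real (s choose m) * (1 - 1 / real p) ^ (k - 1 - m) * (1 / real p ^ m))"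
  \<comment> \<open>For \<open>m > s\<close> the truncated \<open>s - m\<close> breaks the exponent
    identity, but then \<open>s choose m\<close> is 0.\<close>
  proof (cases "m \<le> s")
    case True
    have "(1 - 1 / real p) powi (int s - int k + 1) * (1 - 1 / real p) ^ (k - 1 - m) =
        (1 - 1 / real p) powi (int s - int k + 1) * (1 - 1 / real p) powi int (k - 1 - m)"
      by simp
    also have "\<dots> = (1 - 1 / real p) powi (int s - int k + 1 + int (k - 1 - m))"
      using nz by (subst power_int_add) auto
    also have "int s - int k + 1 + int (k - 1 - m) = int (s - m)"
      using True m assms by simp
    finally show ?thesis
      by (simp add: power_divide)
  qed (simp add: binomial_eq_0)
qed

lemma A_factor_eq_local_density:
  assumes "k \<ge> 1" and "p \<ge> 2"
  shows "A_factor s k p = local_density s k p"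
proof -
  have "{0..k-1} = {..<k}" using assms by auto
  then show ?thesis
    unfolding A_factor_def using local_density_eq[of k k p s] assms by simp
qed

text \<open>The factor in \<open>f_const\<close> is a conditional probability: fewer than
  \<open>i\<close> divisible entries, given fewer than \<open>k\<close>.\<close>

lemma local_density_times_f_factor:
  assumes "i \<le> k" and "k \<ge> 1" and "p \<ge> 2"
  shows "local_density s k p *
    (1 - (\<Sum>m=i..k-1. real (s choose m) * (real p - 1) ^ (k - 1 - m)) /
         (\<Sum>m=0..k-1. real (s choose m) * (real p - 1) ^ (k - 1 - m))) = local_density s i p"
proof -
  let ?h = "\<lambda>m. real (s choose m) * (real p - 1) ^ (k - 1 - m)"
  \<comment> \<open>Clearing the denominator \<open>p ^ (k - 1)\<close> turns powers of
    \<open>1 - 1 / p\<close> into powers of \<open>p - 1\<close>. The constant is the same for every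
    threshold, so it cancels in the quotient.\<close>
  define c where "c = (1 - 1 / real p) powi (int s - int k + 1) / real p ^ (k - 1)"
  have eq: "local_density s t p = c * (\<Sum>m<t. ?h m)" if "t \<le> k" for t
  proof -
    have "(1 - 1 / real p) ^ (k - 1 - m) * (1 / real p ^ m) = (real p - 1) ^ (k - 1 - m) / real p ^ (k - 1)"
      if "m < t" for m
    proof -
      have "1 - 1 / real p = (real p - 1) / real p"
        using assms by (simp add: field_simps)
      moreover have "real p ^ (k - 1) = real p ^ (k - 1 - m) * real p ^ m"
        using that \<open>t \<le> k\<close> by (simp add: power_add[symmetric])
      ultimately show ?thesis by (simp add: power_divide)
    qed
    then have "(\<Sum>m<t. real (s choose m) * (1 - 1 / real p) ^ (k - 1 - m) * (1 / real p ^ m)) =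
        (\<Sum>m<t. ?h m / real p ^ (k - 1))"
      by (intro sum.cong refl) (simp only: mult.assoc lessThan_iff, simp)
    then show ?thesis
      unfolding local_density_eq[OF assms(2) that assms(3)] c_def
      by (simp add: sum_divide_distrib[symmetric])
  qed
  have sets: "{0..k-1} = {..<k}" "{i..k-1} = {..<k} - {..<i}"
    using assms by auto
  have diff: "(\<Sum>m\<in>{..<k} - {..<i}. ?h m) = (\<Sum>m<k. ?h m) - (\<Sum>m<i. ?h m)"
    using assms by (intro sum_diff) auto
  have nz: "(\<Sum>m<k. ?h m) \<noteq> 0"
    using local_density_pos[of k p s] eq[of k] assms by auto
  have "c * y * (1 - (y - x) / y) = c * x" if "y \<noteq> 0" for x y :: real
    using that by (simp add: field_simps)
  from this[OF nz] show ?thesis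
    unfolding sets diff eq[OF assms(1)] eq[OF order_refl] .
qed

section \<open>The contribution of large primes\<close>

text \<open>Telescoping, from \<open>1 / (n + 1)^2 \<le> 1 / n - 1 / (n + 1)\<close>.\<close>

lemma sum_inverse_squares_tail:
  assumes "N \<ge> 1" and "N \<le> n"
  shows "(\<Sum>p\<in>{N<..n}. 1 / real p ^ 2) \<le> 1 / real N - 1 / real n"
  using assms(2)
proof (induction n rule: dec_induct)
  case (step n)
  have "n \<ge> 1" using step assms by simp
  then have "1 / real (Suc n) ^ 2 \<le> 1 / real n - 1 / real (Suc n)"
    by (simp add: divide_simps power2_eq_square)
  moreover have "{N<..Suc n} = insert (Suc n) {N<..n}"
    using step by auto
  ultimately show ?case using step by simp
qed simp

text \<open>The two distinct coordinates \<open>i\<close> and \<open>j\<close> have at most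
  \<open>n / p\<close> choices each, the others \<open>n\<close>.\<close>

lemma card_tuples_two_divisible:
  assumes "i \<in> {1..s}" and "j \<in> {1..s}" and "i \<noteq> j"
  shows "real (card {a \<in> tuples s n. p dvd a i \<and> p dvd a j}) \<le> real n ^ s * (1 / real p ^ 2)"
proof -
  have "{a \<in> tuples s n. p dvd a i \<and> p dvd a j} =
      {a \<in> tuples s n. \<forall>l\<in>{1..s}. l \<in> {i, j} \<longrightarrow> p dvd a l}"
    using assms by auto
  then have "real (card {a \<in> tuples s n. p dvd a i \<and> p dvd a j}) =
      (\<Prod>l\<in>{1..s}. real (card {x \<in> {1..n}. l \<in> {i, j} \<longrightarrow> p dvd x}))"
    using card_tuples_coordinatewise[of s n "\<lambda>l x. l \<in> {i, j} \<longrightarrow> p dvd x"] by simp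
  also have "\<dots> \<le> (\<Prod>l\<in>{1..s}. real n * (if l \<in> {i, j} then 1 / real p else 1))"
  proof (intro prod_mono conjI)
    fix l
    \<comment> \<open>For \<open>p = 0\<close> both sides are 0: no positive integer is a multiple
      of 0, and \<open>n div 0 = 0\<close>.\<close>
    have "card {x \<in> {1..n}. p dvd x} = n div p"
      using card_multiples[of p n] by (cases "p = 0") auto
    moreover have "card {x \<in> {1..n}. l \<in> {i, j} \<longrightarrow> p dvd x} =
        (if l \<in> {i, j} then card {x \<in> {1..n}. p dvd x} else n)"
    proof (cases "l \<in> {i, j}")
      case False
      then have "{x \<in> {1..n}. l \<in> {i, j} \<longrightarrow> p dvd x} = {1..n}" by blast
      with False show ?thesis by (simp only: card_atLeastAtMost) simp
    qed simp
    ultimately show "real (card {x \<in> {1..n}. l \<in> {i, j} \<longrightarrow> p dvd x}) \<le>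
        real n * (if l \<in> {i, j} then 1 / real p else 1)"
      using of_nat_div_le_of_nat[where 'a = real, of n p] by (simp only:) simp
  qed simp
  also have "\<dots> = real n ^ s * (1 / real p) ^ card ({1..s} \<inter> {i, j})"
    by (simp add: prod.distrib prod.If_cases del: insert_iff)
  also have "{1..s} \<inter> {i, j} = {i, j}" using assms by auto
  finally show ?thesis using assms by (simp add: power_divide power2_eq_square)
qed

text \<open>The threshold depends on the prime, so that the \<open>k\<close>-wise condition and all
  conditions on the \<open>u i\<close> become one condition per prime.\<close>

definition few_divisible :: "nat \<Rightarrow> (nat \<Rightarrow> nat) \<Rightarrow> nat \<Rightarrow> (nat \<Rightarrow> nat) \<Rightarrow> bool" where
  "few_divisible s t p a \<longleftrightarrow> card {j \<in> {1..s}. p dvd a j} < t p"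

lemma few_divisible_upto_density:
  "(\<lambda>n. real (card {a \<in> tuples s n. \<forall>p\<in>{p. prime p \<and> p \<le> N}. few_divisible s t p a}) / real n ^ s)
     \<longlonglongrightarrow> (\<Prod>p\<in>{p. prime p \<and> p \<le> N}. local_density s (t p) p)"
proof -
  have "(\<lambda>n. real (card {a \<in> tuples s n. \<forall>p\<in>{p. prime p \<and> p \<le> N}.
      {j \<in> {1..s}. p dvd a j} \<in> {T. T \<subseteq> {1..s} \<and> card T < t p}}) / real n ^ s)
    \<longlonglongrightarrow> (\<Prod>p\<in>{p. prime p \<and> p \<le> N}. \<Sum>T\<in>{T. T \<subseteq> {1..s} \<and> card T < t p}.
      \<Prod>j\<in>{1..s}. if j \<in> T then 1 / real p else 1 - 1 / real p)"
    by (rule finitely_many_primes_density) auto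
  moreover have "{j \<in> {1..s}. p dvd a j} \<in> {T. T \<subseteq> {1..s} \<and> card T < t p} \<longleftrightarrow> few_divisible s t p a"
    for p a
    by (auto simp: few_divisible_def)
  ultimately show ?thesis
    by (simp only: sum_patterns_eq_local_density)
qed

text \<open>Union bound over pairs of indices and over all integers \<open>p\<close> with
  \<open>N < p \<le> n\<close>, prime or not.\<close>

lemma few_divisible_tail:
  assumes "N \<ge> 1" and "\<And>p. prime p \<Longrightarrow> p > N \<Longrightarrow> t p \<ge> 2"
  shows "real (card {a \<in> tuples s n. \<forall>p\<in>{p. prime p \<and> p \<le> N}. few_divisible s t p a}) \<le>
    real (card {a \<in> tuples s n. \<forall>p. prime p \<longrightarrow> few_divisible s t p a}) + real n ^ s * (real s ^ 2 / real N)"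
    (is "real (card ?E) \<le> real (card ?F) + _")
proof -
  let ?I = "{1..s} \<times> {1..s} - Id"
  let ?B = "\<lambda>p ij. {a \<in> tuples s n. p dvd a (fst ij) \<and> p dvd a (snd ij)}"
  have "?E \<subseteq> ?F \<union> (\<Union>p\<in>{N<..n}. \<Union>ij\<in>?I. ?B p ij)"
  proof
    fix a assume a: "a \<in> ?E"
    show "a \<in> ?F \<union> (\<Union>p\<in>{N<..n}. \<Union>ij\<in>?I. ?B p ij)"
    proof (cases "a \<in> ?F")
      case False
      then obtain p where p: "prime p" "\<not> few_divisible s t p a" using a by auto
      then have "p > N" using a not_less by blast
      then have "card {j \<in> {1..s}. p dvd a j} \<ge> 2"
        using p assms(2)[of p] by (simp add: few_divisible_def)
      then obtain T where "T \<subseteq> {j \<in> {1..s}. p dvd a j}" "card T = 2"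
        by (meson obtain_subset_with_card_n)
      then obtain i j where ij: "i \<in> {1..s}" "j \<in> {1..s}" "i \<noteq> j" "p dvd a i" "p dvd a j"
        unfolding card_2_iff by blast
      \<comment> \<open>A divisor of an entry is at most \<open>n\<close>, which makes the union
        finite.\<close>
      have "a i \<in> {1..n}" using a ij(1) by (auto simp: tuples_def)
      then have "p \<le> n" using ij(4) by (auto dest: dvd_imp_le)
      then have "p \<in> {N<..n}" "(i, j) \<in> ?I" "a \<in> ?B p (i, j)" using \<open>p > N\<close> ij a by auto
      then show ?thesis by blast
    qed simp
  qed
  then have "card ?E \<le> card (?F \<union> (\<Union>p\<in>{N<..n}. \<Union>ij\<in>?I. ?B p ij))"
    by (rule card_mono[rotated]) (auto simp: finite_tuples)
  also have "\<dots> \<le> card ?F + (\<Sum>p\<in>{N<..n}. \<Sum>ij\<in>?I. card (?B p ij))"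
    by (intro order_trans[OF card_Un_le] add_left_mono order_trans[OF card_UN_le] sum_mono) auto
  finally have "real (card ?E) \<le> real (card ?F) + (\<Sum>p\<in>{N<..n}. \<Sum>ij\<in>?I. real (card (?B p ij)))"
    by (simp only: of_nat_sum[symmetric] of_nat_add[symmetric] of_nat_le_iff)
  also have "(\<Sum>p\<in>{N<..n}. \<Sum>ij\<in>?I. real (card (?B p ij))) \<le>
      (\<Sum>p\<in>{N<..n}. \<Sum>ij\<in>?I. real n ^ s * (1 / real p ^ 2))"
    by (intro sum_mono card_tuples_two_divisible) auto
  also have "\<dots> = real n ^ s * (real (card ?I) * (\<Sum>p\<in>{N<..n}. 1 / real p ^ 2))"
    by (simp only: sum_constant sum_distrib_left mult_ac)
  also have "\<dots> \<le> real n ^ s * (real s ^ 2 * (1 / real N))"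
  proof (intro mult_left_mono mult_mono)
    have "card ?I \<le> card ({1..s} \<times> {1..s})" by (rule card_mono) auto
    then have "card ?I \<le> s ^ 2" by (simp add: power2_eq_square)
    then show "real (card ?I) \<le> real s ^ 2"
      by (metis of_nat_le_iff of_nat_power)
    show "(\<Sum>p\<in>{N<..n}. 1 / real p ^ 2) \<le> 1 / real N"
    proof (cases "N \<le> n")
      case True
      have "0 \<le> 1 / real n" by simp
      then show ?thesis
        using sum_inverse_squares_tail[OF assms(1) True] by linarith
    qed simp
  qed (auto intro: sum_nonneg)
  finally show ?thesis by simp
qed

section \<open>Passage from finitely many primes to all primes\<close>

text \<open>The tail estimate is uniform in \<open>n \<ge> 1\<close>, so \<open>N\<close> can be
  fixed before \<open>n\<close> grows; three errors of size \<open>r / 3\<close> remain. Thresholds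
  below 2 may occur only up to \<open>N0\<close>.\<close>

lemma few_divisible_density:
  assumes "\<And>p. prime p \<Longrightarrow> p > N0 \<Longrightarrow> t p \<ge> 2"
    and lim: "(\<lambda>N. \<Prod>p\<in>{p. prime p \<and> p \<le> N}. local_density s (t p) p) \<longlonglongrightarrow> L"
  shows "(\<lambda>n. real (card {a \<in> tuples s n. \<forall>p. prime p \<longrightarrow> few_divisible s t p a}) / real n ^ s)
    \<longlonglongrightarrow> L"
proof (rule LIMSEQ_I)
  let ?x = "\<lambda>n. real (card {a \<in> tuples s n. \<forall>p. prime p \<longrightarrow> few_divisible s t p a}) / real n ^ s"
  let ?y = "\<lambda>N n. real (card {a \<in> tuples s n. \<forall>p\<in>{p. prime p \<and> p \<le> N}. few_divisible s t p a}) / real n ^ s"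
  let ?L = "\<lambda>N. \<Prod>p\<in>{p. prime p \<and> p \<le> N}. local_density s (t p) p"
  fix r :: real assume "r > 0"
  have "\<forall>\<^sub>F N in sequentially. dist (?L N) L < r / 3"
    using lim \<open>r > 0\<close> by (intro tendstoD) auto
  moreover have "\<forall>\<^sub>F N in sequentially. dist (real s ^ 2 / real N) 0 < r / 3"
    using lim_const_over_n[of "real s ^ 2"] \<open>r > 0\<close> by (intro tendstoD) auto
  moreover have "\<forall>\<^sub>F N in sequentially. N \<ge> max 1 N0"
    by (rule eventually_ge_at_top)
  ultimately have "\<forall>\<^sub>F N in sequentially.
      dist (?L N) L < r / 3 \<and> dist (real s ^ 2 / real N) 0 < r / 3 \<and> N \<ge> max 1 N0"
    by eventually_elim simp
  then obtain N where N: "dist (?L N) L < r / 3" "dist (real s ^ 2 / real N) 0 < r / 3" "N \<ge> 1" "N \<ge> N0"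
    by (auto simp: eventually_sequentially)
  have "\<forall>\<^sub>F n in sequentially. dist (?y N n) (?L N) < r / 3"
    using few_divisible_upto_density \<open>r > 0\<close> by (intro tendstoD) auto
  then obtain n0 where n0: "\<And>n. n \<ge> n0 \<Longrightarrow> dist (?y N n) (?L N) < r / 3"
    by (auto simp: eventually_sequentially)
  have "norm (?x n - L) < r" if "n \<ge> max 1 n0" for n
  proof -
    \<comment> \<open>Restricting to primes up to \<open>N\<close> admits more tuples, and by the
      tail estimate only few more.\<close>
    have "?x n \<le> ?y N n"
      by (intro divide_right_mono of_nat_mono card_mono) (auto simp: finite_tuples)
    moreover have "?y N n \<le> ?x n + real s ^ 2 / real N"
      using few_divisible_tail[of N t s n] assms(1) N that
      by (simp add: field_simps)
    moreover have "dist (?y N n) (?L N) < r / 3" using n0 that by simp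
    ultimately show ?thesis
      using N(1,2) unfolding dist_real_def real_norm_def abs_less_iff by linarith
  qed
  then show "\<exists>no. \<forall>n\<ge>no. norm (?x n - L) < r" by blast
qed

section \<open>Coprimality conditions read prime by prime\<close>

text \<open>A gcd differs from 1 exactly when some prime divides it, that is, divides all the chosen
  entries. So the condition fails exactly when \<open>k\<close> indices share a prime.\<close>

lemma kwise_coprime_iff:
  "kwise_coprime s k a \<longleftrightarrow> (\<forall>p. prime p \<longrightarrow> card {j \<in> {1..s}. p dvd a j} < k)"
proof (intro iffI allI impI)
  fix p :: nat assume kw: "kwise_coprime s k a" and "prime p"
  show "card {j \<in> {1..s}. p dvd a j} < k"
  proof (rule ccontr)
    assume "\<not> ?thesis"
    then obtain I where "I \<subseteq> {j \<in> {1..s}. p dvd a j}" "card I = k"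
      by (meson not_less obtain_subset_with_card_n)
    then have "p dvd Gcd (a ` I)" "I \<subseteq> {1..s} \<and> card I = k"
      by (auto intro!: Gcd_greatest)
    moreover from this have "Gcd (a ` I) = 1"
      using kw unfolding kwise_coprime_def by blast
    ultimately show False using \<open>prime p\<close> by simp
  qed
next
  assume *: "\<forall>p. prime p \<longrightarrow> card {j \<in> {1..s}. p dvd a j} < k"
  show "kwise_coprime s k a"
    unfolding kwise_coprime_def
  proof (intro allI impI, rule ccontr)
    fix I assume I: "I \<subseteq> {1..s} \<and> card I = k" and "Gcd (a ` I) \<noteq> 1"
    then obtain p where p: "prime p" "p dvd Gcd (a ` I)" by (meson prime_factor_nat)
    then have "I \<subseteq> {j \<in> {1..s}. p dvd a j}"
      using I by (auto simp: dvd_Gcd_iff)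
    then have "card I \<le> card {j \<in> {1..s}. p dvd a j}"
      by (rule card_mono[rotated]) simp
    moreover have "card {j \<in> {1..s}. p dvd a j} < k" using * p(1) by blast
    ultimately show False using I by linarith
  qed
qed

lemma iwise_coprime_to_iff:
  "iwise_coprime_to s i a b \<longleftrightarrow> (\<forall>p. prime p \<longrightarrow> p dvd b \<longrightarrow> card {j \<in> {1..s}. p dvd a j} < i)"
proof (intro iffI allI impI)
  fix p :: nat assume iw: "iwise_coprime_to s i a b" and "prime p" "p dvd b"
  show "card {j \<in> {1..s}. p dvd a j} < i"
  proof (rule ccontr)
    assume "\<not> ?thesis"
    then obtain I where "I \<subseteq> {j \<in> {1..s}. p dvd a j}" "card I = i"
      by (meson not_less obtain_subset_with_card_n)
    moreover from this have "I \<subseteq> {1..s}" by auto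
    ultimately have "p dvd Gcd (a ` I)" "coprime (Gcd (a ` I)) b"
      using iw by (auto simp: iwise_coprime_to_def intro!: Gcd_greatest)
    then show False
      using \<open>prime p\<close> \<open>p dvd b\<close> by (metis coprime_common_divisor not_prime_unit)
  qed
next
  assume *: "\<forall>p. prime p \<longrightarrow> p dvd b \<longrightarrow> card {j \<in> {1..s}. p dvd a j} < i"
  show "iwise_coprime_to s i a b"
    unfolding iwise_coprime_to_def
  proof (intro allI impI, rule ccontr)
    fix I assume I: "I \<subseteq> {1..s} \<and> card I = i" and "\<not> coprime (Gcd (a ` I)) b"
    then obtain p where p: "prime p" "p dvd Gcd (a ` I)" "p dvd b"
      using prime_factor_nat[of "gcd (Gcd (a ` I)) b"] by (auto simp: coprime_iff_gcd_eq_1)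
    then have "I \<subseteq> {j \<in> {1..s}. p dvd a j}"
      using I by (auto simp: dvd_Gcd_iff)
    then have "card I \<le> card {j \<in> {1..s}. p dvd a j}"
      by (rule card_mono[rotated]) simp
    moreover have "card {j \<in> {1..s}. p dvd a j} < i" using * p(1,3) by blast
    ultimately show False using I by linarith
  qed
qed

section \<open>Convergence of the product over all primes\<close>

text \<open>At each prime the factor differs from 1 by at most \<open>2 ^ s / p^2\<close>, so the
  product converges absolutely.\<close>

lemma convergent_prod_A_prime_factor:
  assumes "k \<ge> 2"
  shows "convergent_prod (A_prime_factor s k)"
proof (rule abs_convergent_prod_imp_convergent_prod)
  have "summable (\<lambda>p. 2 ^ s * (1 / real p ^ 2))"
    using inverse_power_summable[of 2, where 'a = real]
    by (intro summable_mult) (simp add: inverse_eq_divide)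
  moreover have "norm (norm (A_prime_factor s k p - 1)) \<le> 2 ^ s * (1 / real p ^ 2)" for p
    using local_density_bound[of k p s] A_factor_eq_local_density[of k p s] assms
    by (auto simp: A_prime_factor_def prime_ge_2_nat prime_gt_0_nat)
  ultimately have "summable (\<lambda>p. norm (A_prime_factor s k p - 1))"
    by (rule summable_comparison_test')
  then show "abs_convergent_prod (A_prime_factor s k)"
    by (simp add: abs_convergent_prod_conv_summable)
qed

lemma A_const_limit:
  assumes "k \<ge> 2"
  shows "(\<lambda>N. \<Prod>p\<in>{p. prime p \<and> p \<le> N}. local_density s k p) \<longlonglongrightarrow> A_const s k"
proof -
  have "(\<Prod>p\<in>{p. prime p \<and> p \<le> N}. local_density s k p) = (\<Prod>p\<le>N. A_prime_factor s k p)" for N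
    by (rule prod.mono_neutral_cong_left)
      (use assms in \<open>auto simp: A_prime_factor_def A_factor_eq_local_density prime_ge_2_nat\<close>)
  then show ?thesis
    unfolding A_const_def
    using convergent_prod_LIMSEQ[OF convergent_prod_A_prime_factor[OF assms]] by simp
qed

section \<open>Thresholds attached to \<open>u\<close> and evaluation of the limit\<close>

theorem corollary2:
  fixes s k :: nat and u :: "nat \<Rightarrow> nat"
  assumes "s \<ge> 1" and "k \<ge> 2"
    and "\<And>i. i \<in> {1..k-1} \<Longrightarrow> u i > 0"
    and "\<And>i j. i \<in> {1..k-1} \<Longrightarrow> j \<in> {1..k-1} \<Longrightarrow> i \<noteq> j \<Longrightarrow> gcd (u i) (u j) = 1"
  shows "convergent_prod (A_prime_factor s k) \<and>
    has_probability s
      (\<lambda>a. kwise_coprime s k a \<and> (\<forall>i\<in>{1..k-1}. iwise_coprime_to s i a (u i)))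
      (A_const s k * (\<Prod>i=1..k-1. f_const s k i (u i))) \<and>
    (\<lambda>n. real (Qcount s k u n) / real n ^ s) \<longlonglongrightarrow> A_const s k * (\<Prod>i=1..k-1. f_const s k i (u i)) \<and>
    has_probability s (kwise_coprime s k) (A_const s k)"
proof -
  define t where "t p = (if \<exists>i\<in>{1..k-1}. p dvd u i then SOME i. i \<in> {1..k-1} \<and> p dvd u i else k)" for p
  \<comment> \<open>Pairwise coprimality of the \<open>u i\<close> lets a prime divide at most one
    of them, so the choice by \<open>SOME\<close> is forced.\<close>
  have t_some: "t p = i" if "prime p" "i \<in> {1..k-1}" "p dvd u i" for p i
  proof -
    have "t p \<in> {1..k-1} \<and> p dvd u (t p)"
      using that someI_ex[of "\<lambda>i. i \<in> {1..k-1} \<and> p dvd u i"] by (auto simp: t_def)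
    then show ?thesis
      using assms(4)[of "t p" i] that by (metis gcd_greatest not_prime_unit)
  qed
  have t_none: "t p = k" if "\<And>i. i \<in> {1..k-1} \<Longrightarrow> \<not> p dvd u i" for p
    using that by (auto simp: t_def)
  let ?P = "\<lambda>a. kwise_coprime s k a \<and> (\<forall>i\<in>{1..k-1}. iwise_coprime_to s i a (u i))"
  let ?f = "\<lambda>i p. 1 - (\<Sum>m=i..k-1. real (s choose m) * (real p - 1) ^ (k - 1 - m)) /
         (\<Sum>m=0..k-1. real (s choose m) * (real p - 1) ^ (k - 1 - m))"
  \<comment> \<open>A bound for every divisor of every \<open>u i\<close>: beyond \<open>U\<close>
    the threshold is \<open>k\<close>, and the products in \<open>f_const\<close> are
    exhausted.\<close>
  define U where "U = (\<Sum>i\<in>{1..k-1}. u i)"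
  have le_U: "p \<le> U" if "i \<in> {1..k-1}" "p dvd u i" for i p
  proof -
    have "p \<le> u i" using that assms(3) by (simp add: dvd_imp_le)
    also have "\<dots> \<le> U" unfolding U_def using that by (intro member_le_sum) auto
    finally show ?thesis .
  qed
  have P_iff: "?P a \<longleftrightarrow> (\<forall>p. prime p \<longrightarrow> few_divisible s t p a)" for a
  proof
    assume P: "?P a"
    show "\<forall>p. prime p \<longrightarrow> few_divisible s t p a"
    proof (intro allI impI)
      fix p :: nat assume "prime p"
      show "few_divisible s t p a"
      proof (cases "\<exists>i\<in>{1..k-1}. p dvd u i")
        case True
        then obtain i where "i \<in> {1..k-1}" "p dvd u i" by blast
        then show ?thesis
          using P \<open>prime p\<close> t_some[of p i] by (auto simp: iwise_coprime_to_iff few_divisible_def)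
      next
        case False
        then show ?thesis
          using P \<open>prime p\<close> t_none[of p] by (auto simp: kwise_coprime_iff few_divisible_def)
      qed
    qed
  next
    assume *: "\<forall>p. prime p \<longrightarrow> few_divisible s t p a"
    \<comment> \<open>At a prime dividing \<open>u i\<close> the threshold is \<open>i < k\<close>,
      so the condition there implies the \<open>k\<close>-wise one.\<close>
    have "t p \<le> k" if "prime p" for p
    proof (cases "\<exists>i\<in>{1..k-1}. p dvd u i")
      case True
      then obtain i where "i \<in> {1..k-1}" "p dvd u i" by blast
      then show ?thesis using t_some[OF that, of i] by auto
    qed (use t_none in auto)
    then have "kwise_coprime s k a"
      using * unfolding kwise_coprime_iff few_divisible_def by (meson less_le_trans)
    moreover have "iwise_coprime_to s i a (u i)" if "i \<in> {1..k-1}" for i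
      using * t_some that unfolding iwise_coprime_to_iff few_divisible_def by metis
    ultimately show "?P a" by blast
  qed
  have factor: "local_density s (t p) p =
      local_density s k p * (\<Prod>i\<in>{1..k-1}. if p dvd u i then ?f i p else 1)" if "prime p" for p
  proof (cases "\<exists>i\<in>{1..k-1}. p dvd u i")
    case True
    then obtain i where i: "i \<in> {1..k-1}" "p dvd u i" by blast
    \<comment> \<open>Only the unique \<open>i\<close> with \<open>p dvd u i\<close> contributes,
      and its factor lowers the threshold from \<open>k\<close> to \<open>i\<close>.\<close>
    have "(\<Prod>i\<in>{1..k-1}. if p dvd u i then ?f i p else 1) = (\<Prod>j\<in>{1..k-1}. if j = i then ?f i p else 1)"
      using t_some[OF that] i by (intro prod.cong) auto
    also have "\<dots> = ?f i p" using i by simp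
    finally show ?thesis
      using local_density_times_f_factor[of i k p s] t_some[OF that i] i assms(2) that
      by (auto simp: prime_ge_2_nat)
  next
    case False
    then have "(\<Prod>i\<in>{1..k-1}. if p dvd u i then ?f i p else 1) = 1"
      by (intro prod.neutral) auto
    then show ?thesis using t_none[of p] False by simp
  qed
  have prods: "(\<Prod>p\<in>{p. prime p \<and> p \<le> N}. local_density s (t p) p) =
      (\<Prod>p\<in>{p. prime p \<and> p \<le> N}. local_density s k p) * (\<Prod>i=1..k-1. f_const s k i (u i))"
    if "N \<ge> U" for N
  proof -
    \<comment> \<open>Padding with factors 1 gives all \<open>i\<close> the same range of primes, so
      that the products over \<open>i\<close> and \<open>p\<close> can be exchanged.\<close>
    have "f_const s k i (u i) = (\<Prod>p\<in>{p. prime p \<and> p \<le> N}. if p dvd u i then ?f i p else 1)"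
      if "i \<in> {1..k-1}" for i
      unfolding f_const_def
      by (rule prod.mono_neutral_cong_left) (use le_U[OF that] \<open>N \<ge> U\<close> in \<open>auto intro: order_trans\<close>)
    then have "(\<Prod>i=1..k-1. f_const s k i (u i)) =
        (\<Prod>i\<in>{1..k-1}. \<Prod>p\<in>{p. prime p \<and> p \<le> N}. if p dvd u i then ?f i p else 1)"
      by (rule prod.cong[OF refl])
    also have "\<dots> = (\<Prod>p\<in>{p. prime p \<and> p \<le> N}. \<Prod>i\<in>{1..k-1}. if p dvd u i then ?f i p else 1)"
      by (rule prod.swap)
    finally show ?thesis
      by (simp add: prod.distrib[symmetric] factor)
  qed
  let ?L = "A_const s k * (\<Prod>i=1..k-1. f_const s k i (u i))"
  have "(\<lambda>N. (\<Prod>p\<in>{p. prime p \<and> p \<le> N}. local_density s k p) * (\<Prod>i=1..k-1. f_const s k i (u i)))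
      \<longlonglongrightarrow> ?L"
    using A_const_limit[OF assms(2)] by (intro tendsto_mult tendsto_const)
  then have "(\<lambda>N. \<Prod>p\<in>{p. prime p \<and> p \<le> N}. local_density s (t p) p) \<longlonglongrightarrow> ?L"
    by (rule Lim_transform_eventually)
      (use prods in \<open>auto simp: eventually_sequentially intro!: exI[of _ U]\<close>)
  \<comment> \<open>Primes dividing \<open>u 1\<close> have threshold 1, so the tail estimate is
    applied only beyond \<open>U\<close>.\<close>
  moreover have "t p \<ge> 2" if "p > U" for p
    using t_none[of p] le_U[of _ p] that assms(2) by fastforce
  ultimately have lim: "(\<lambda>n. real (card {a \<in> tuples s n. ?P a}) / real n ^ s) \<longlonglongrightarrow> ?L"
    unfolding P_iff by (intro few_divisible_density[of U]) auto
  \<comment> \<open>The plain \<open>k\<close>-wise case is the constant threshold \<open>k\<close>,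
    which is at least 2 at every prime.\<close>
  have "(\<lambda>n. real (card {a \<in> tuples s n. kwise_coprime s k a}) / real n ^ s) \<longlonglongrightarrow> A_const s k"
    using few_divisible_density[OF _ A_const_limit[OF assms(2)], of 0] assms(2)
    by (simp add: kwise_coprime_iff few_divisible_def)
  with lim convergent_prod_A_prime_factor[OF assms(2)] show ?thesis
    by (simp add: has_probability_def card_tuples Qcount_def)
qed

end
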